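(* Suppose $\lambda=r-is$, where $r,s\in\mathbb{R}$ and $s>0$. Let $E(x,t,\lambda)$ be a frame of a solution $q$ of $(\mathrm{GP}^+)$. Define $$\eta(x,t)=E(x,t,\lambda)E(x,t,\bar\lambda)^{-1}\quad\text{and}\quad \gamma(x,t)=\eta\left(\frac{x}{2s}-\frac{r}{s}t,\ \frac{t}{2s}\right).$$ Then $\gamma(x,t)$ solves the Hodge star mean curvature flow $\gamma_t=*_\gamma(H(\gamma(\cdot,t)))$ on $\mathbb{H}^3$.
   Context: $(\mathrm{GP}^+)$ is the equation $q_t=\frac i2(q_{xx}+q+2|q|^2q)$ for $q:\mathbb{R}^2\to\mathbb{C}$. Let $a=\mathrm{diag}(i,-i)$, $u=\begin{pmatrix}0&q\\-\bar q&0\end{pmatrix}$, $Q_{-1}=\frac i2\begin{pmatrix}-|q|^2&q_x\\ \bar q_x&|q|^2\end{pmatrix}$. A frame of a solution $q$ is a map $E(x,t,\lambda)$, $\lambda\in\mathbb{C}$, with $$E^{-1}E_x=a\lambda+u,\qquad E^{-1}E_t=a\lambda^2+u\lambda+Q_{-1}-\tfrac14a,$$ satisfying the $SU(2)$-reality condition $E(x,t,\bar\lambda)^*E(x,t,\lambda)=I_2$, and with determinant $1$. Minkowski space (metric $-dx_0^2+dx_1^2+dx_2^2+dx_3^2$) is identified with the $2\times2$ self-adjoint matrices via $(x_0,x_1,x_2,x_3)\mapsto\begin{pmatrix}x_0-x_3&x_1-ix_2\\ x_1+ix_2&x_0+x_3\end{pmatrix}$, so that $\det=x_0^2-x_1^2-x_2^2-x_3^2$;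 $\mathbb{H}^3$ is the hyperquadric $-x_0^2+x_1^2+x_2^2+x_3^2=-1$, i.e. the set of self-adjoint matrices of determinant $1$. The space of self-adjoint matrices has the oriented orthonormal basis $(I_2,a_M,b_M,c_M)$, where $a_M=\mathrm{diag}(1,-1)$, $b_M=\begin{pmatrix}0&-i\\i&0\end{pmatrix}$, $c_M=\begin{pmatrix}0&1\\1&0\end{pmatrix}$. Star mean curvature flow on $\mathbb{H}^3$: $H$ is the mean curvature vector of the curve $\gamma(\cdot,t)$ in $\mathbb{H}^3$, and $*_\gamma$ is the Hodge star (rotation by $\pi/2$) of the oriented normal plane of the curve in $\mathbb{H}^3$: $*(n_2)=n_3$, $*(n_3)=-n_2$ for an orthonormal normal basis $(n_2,n_3)$ such that $(\gamma,\gamma_x,n_2,n_3)$ (with $x$ arc length) is positively oriented. If $H=\xi_1n_2+\xi_2n_3$, the flow reads $\gamma_t=\xi_1n_3-\xi_2n_2$.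
   Formalization: The time scaling is corrected to γ(x,t) = η(x/(2s) − (r/s²)t, t/(2s²)); with s in place of s² as printed, γ satisfies γ_t = s·*H instead, so the claim fails when s ≠ 1 and q ≠ 0. Both versions agree at s = 1. *)

theory Defs
  imports "HOL-Analysis.Analysis"
begin

type_synonym cmat2 = "complex^2^2"

definition mat22 :: "complex \<Rightarrow> complex \<Rightarrow> complex \<Rightarrow> complex \<Rightarrow> cmat2" where
  "mat22 a b c d = vector [vector [a, b], vector [c, d]]"

definition ctransp :: "cmat2 \<Rightarrow> cmat2" where
  "ctransp A = (\<chi> i j. cnj (A $ j $ i))"

definition self_adjoint :: "cmat2 \<Rightarrow> bool" where
  "self_adjoint A \<longleftrightarrow> ctransp A = A"

definition cscale :: "complex \<Rightarrow> cmat2 \<Rightarrow> cmat2" where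
  "cscale c A = (\<chi> i. c *s A $ i)"

definition dx :: "(real \<Rightarrow> real \<Rightarrow> 'a::real_normed_vector) \<Rightarrow> real \<Rightarrow> real \<Rightarrow> 'a" where
  "dx f x t = vector_derivative (\<lambda>y. f y t) (at x)"

definition dt :: "(real \<Rightarrow> real \<Rightarrow> 'a::real_normed_vector) \<Rightarrow> real \<Rightarrow> real \<Rightarrow> 'a" where
  "dt f x t = vector_derivative (\<lambda>\<tau>. f x \<tau>) (at t)"

text \<open>Classical regularity: exactly the derivatives occurring in an equation are required to
  exist.\<close>

definition classical :: "(real \<Rightarrow> real \<Rightarrow> 'a::real_normed_vector) \<Rightarrow> bool" where
  "classical f \<longleftrightarrow> (\<forall>x t. (\<lambda>y. f y t) differentiable at x \<and>
     (\<lambda>y. dx f y t) differentiable at x \<and> (\<lambda>\<tau>. f x \<tau>) differentiable at t)"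

definition solves_GP_plus :: "(real \<Rightarrow> real \<Rightarrow> complex) \<Rightarrow> bool" where
  "solves_GP_plus q \<longleftrightarrow> classical q \<and>
     (\<forall>x t. dt q x t =
        \<i> / 2 * (dx (dx q) x t + q x t + 2 * (complex_of_real (cmod (q x t)))\<^sup>2 * q x t))"

definition a_mat :: cmat2 where
  "a_mat = mat22 \<i> 0 0 (- \<i>)"

definition u_mat :: "(real \<Rightarrow> real \<Rightarrow> complex) \<Rightarrow> real \<Rightarrow> real \<Rightarrow> cmat2" where
  "u_mat q x t = mat22 0 (q x t) (- cnj (q x t)) 0"

definition Q_mat :: "(real \<Rightarrow> real \<Rightarrow> complex) \<Rightarrow> real \<Rightarrow> real \<Rightarrow> cmat2" where
  "Q_mat q x t = cscale (\<i> / 2)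
     (mat22 (- (complex_of_real (cmod (q x t)))\<^sup>2) (dx q x t)
            (cnj (dx q x t)) ((complex_of_real (cmod (q x t)))\<^sup>2))"

text \<open>The map \<open>(x, t) \<mapsto> E x t lam\<close> is required to be differentiable on the plane, not just
  in each variable separately; no regularity in \<open>lam\<close> is assumed.\<close>

definition is_frame ::
    "(real \<Rightarrow> real \<Rightarrow> complex) \<Rightarrow> (real \<Rightarrow> real \<Rightarrow> complex \<Rightarrow> cmat2) \<Rightarrow> bool" where
  "is_frame q E \<longleftrightarrow> (\<forall>lam.
     (\<forall>p. (\<lambda>p. E (fst p) (snd p) lam) differentiable at p) \<and>
     (\<forall>x t.
        matrix_inv (E x t lam) ** dx (\<lambda>x t. E x t lam) x t = cscale lam a_mat + u_mat q x t \<and>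
        matrix_inv (E x t lam) ** dt (\<lambda>x t. E x t lam) x t
          = cscale (lam\<^sup>2) a_mat + cscale lam (u_mat q x t) + Q_mat q x t - cscale (1 / 4) a_mat \<and>
        ctransp (E x t (cnj lam)) ** E x t lam = mat 1 \<and>
        det (E x t lam) = 1))"

definition mink_mat :: "real \<Rightarrow> real \<Rightarrow> real \<Rightarrow> real \<Rightarrow> cmat2" where
  "mink_mat x0 x1 x2 x3 =
     mat22 (of_real (x0 - x3)) (Complex x1 (- x2)) (Complex x1 x2) (of_real (x0 + x3))"

text \<open>The inverse coordinates; they are meaningful on self-adjoint matrices only.\<close>

definition mink_coord :: "cmat2 \<Rightarrow> real^4" where
  "mink_coord A = vector [Re (A $ 1 $ 1 + A $ 2 $ 2) / 2, Re (A $ 2 $ 1), Im (A $ 2 $ 1),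
                          Re (A $ 2 $ 2 - A $ 1 $ 1) / 2]"

definition mink :: "cmat2 \<Rightarrow> cmat2 \<Rightarrow> real" where
  "mink A B = (let x = mink_coord A; y = mink_coord B in
     - x $ 1 * y $ 1 + x $ 2 * y $ 2 + x $ 3 * y $ 3 + x $ 4 * y $ 4)"

definition H3 :: "cmat2 set" where
  "H3 = {A. self_adjoint A \<and> det A = 1}"

lemma vector_4_nth [simp]:
  "(vector [w, x, y, z] :: 'a::zero^4) $ 1 = w"
  "(vector [w, x, y, z] :: 'a::zero^4) $ 2 = x"
  "(vector [w, x, y, z] :: 'a::zero^4) $ 3 = y"
  "(vector [w, x, y, z] :: 'a::zero^4) $ 4 = z"
  unfolding vector_def by simp_all

lemma mink_coord_mink_mat: "mink_coord (mink_mat x0 x1 x2 x3) = vector [x0, x1, x2, x3]"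
  by (simp add: mink_coord_def mink_mat_def mat22_def)

lemma self_adjoint_iff:
  "self_adjoint A \<longleftrightarrow> Im (A $ 1 $ 1) = 0 \<and> Im (A $ 2 $ 2) = 0 \<and> A $ 1 $ 2 = cnj (A $ 2 $ 1)"
  by (auto simp: self_adjoint_def ctransp_def vec_eq_iff forall_2 complex_eq_iff)

lemma mink_mat_mink_coord:
  assumes "self_adjoint A"
  shows "A = mink_mat (mink_coord A $ 1) (mink_coord A $ 2) (mink_coord A $ 3) (mink_coord A $ 4)"
  using assms
  by (auto simp: self_adjoint_iff mink_mat_def mat22_def mink_coord_def vec_eq_iff forall_2
      complex_eq_iff field_simps)

lemma mink_self: "self_adjoint A \<Longrightarrow> complex_of_real (mink A A) = - det A"
  by (auto simp: self_adjoint_iff mink_def mink_coord_def det_2 complex_eq_iff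
      field_simps power2_eq_square)

lemma H3_iff: "A \<in> H3 \<longleftrightarrow> self_adjoint A \<and> mink A A = - 1"
  using mink_self [of A] by (auto simp: H3_def complex_eq_iff)

text \<open>The oriented orthonormal basis \<open>(I\<^sub>2, a\<^sub>M, b\<^sub>M, c\<^sub>M)\<close>.\<close>

definition mink_basis :: "cmat2^4" where
  "mink_basis = vector [mat 1, mat22 1 0 0 (- 1), mat22 0 (- \<i>) \<i> 0, mat22 0 1 1 0]"

definition pos_oriented :: "cmat2 \<Rightarrow> cmat2 \<Rightarrow> cmat2 \<Rightarrow> cmat2 \<Rightarrow> bool" where
  "pos_oriented v1 v2 v3 v4 \<longleftrightarrow> (\<exists>A :: real^4^4. det A > 0 \<and>
     (\<forall>i. (vector [v1, v2, v3, v4] :: cmat2^4) $ i = (\<Sum>j\<in>UNIV. A $ i $ j *\<^sub>R mink_basis $ j)))"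

text \<open>Positively oriented orthonormal bases of the normal plane, in the tangent space of \<open>H3\<close>
  at \<open>p\<close>, of a curve with unit tangent \<open>T\<close>.\<close>

definition normal_frame :: "cmat2 \<Rightarrow> cmat2 \<Rightarrow> cmat2 \<Rightarrow> cmat2 \<Rightarrow> bool" where
  "normal_frame p T n2 n3 \<longleftrightarrow> self_adjoint n2 \<and> self_adjoint n3 \<and>
     mink n2 p = 0 \<and> mink n2 T = 0 \<and> mink n3 p = 0 \<and> mink n3 T = 0 \<and>
     mink n2 n2 = 1 \<and> mink n3 n3 = 1 \<and> mink n2 n3 = 0 \<and>
     pos_oriented p T n2 n3"

definition hodge_star :: "cmat2 \<Rightarrow> cmat2 \<Rightarrow> cmat2 \<Rightarrow> cmat2" where
  "hodge_star p T v = (THE w. \<exists>n2 n3 \<xi>1 \<xi>2. normal_frame p T n2 n3 \<and>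
     v = \<xi>1 *\<^sub>R n2 + \<xi>2 *\<^sub>R n3 \<and> w = \<xi>1 *\<^sub>R n3 - \<xi>2 *\<^sub>R n2)"

text \<open>Orthogonal projection to the plane normal to \<open>p\<close> and \<open>T\<close>, for \<open>p \<in> H3\<close> (hence the plus
  sign) and \<open>T\<close> a space-like vector tangent to \<open>H3\<close> at \<open>p\<close>.\<close>

definition normal_part :: "cmat2 \<Rightarrow> cmat2 \<Rightarrow> cmat2 \<Rightarrow> cmat2" where
  "normal_part p T v = v + mink v p *\<^sub>R p - (mink v T / mink T T) *\<^sub>R T"

text \<open>The mean curvature vector in \<open>H3\<close> of a regular curve: its second fundamental form in \<open>H3\<close>,
  which is the normal part of the ambient second derivative, traced with the induced metric.\<close>

definition mean_curvature :: "(real \<Rightarrow> cmat2) \<Rightarrow> real \<Rightarrow> cmat2" where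
  "mean_curvature c x =
     (let c' = (\<lambda>y. vector_derivative c (at y)); c'' = vector_derivative c' (at x)
      in (1 / mink (c' x) (c' x)) *\<^sub>R normal_part (c x) (c' x) c'')"

text \<open>As the orientation convention presupposes, \<open>x\<close> is arc length on each curve \<open>\<gamma>(\<cdot>, t)\<close>.\<close>

definition solves_star_mcf :: "(real \<Rightarrow> real \<Rightarrow> cmat2) \<Rightarrow> bool" where
  "solves_star_mcf \<gamma> \<longleftrightarrow> classical \<gamma> \<and>
     (\<forall>x t. \<gamma> x t \<in> H3 \<and> mink (dx \<gamma> x t) (dx \<gamma> x t) = 1 \<and>
        dt \<gamma> x t = hodge_star (\<gamma> x t) (dx \<gamma> x t) (mean_curvature (\<lambda>y. \<gamma> y t) x))"

text \<open>For \<open>lam = r - \<i> * s\<close> and \<open>\<eta> = E(lam) E(cnj lam)\<^sup>-\<^sup>1\<close>, the reparametrization that solves this flow is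
  \<open>\<gamma>(x, t) = \<eta>(x / (2 s) - r t / s\<^sup>2, t / (2 s\<^sup>2))\<close>. With \<open>s\<close> in place of both \<open>s\<^sup>2\<close>, as printed in the
  source, \<open>x\<close> is still arc length, but \<open>\<gamma>\<close> satisfies \<open>\<gamma>\<^sub>t = s *\<^sub>\<gamma>(H)\<close> instead.\<close>

end

theory Submission
  imports Defs
begin

text \<open>
  Write \<open>P\<close> for \<open>E x t lam\<close> and \<open>P\<^sup>*\<close> for its adjoint. The reality condition says that the inverse of
  \<open>E x t (cnj lam)\<close> is \<open>P\<^sup>*\<close>, so \<open>\<eta> = P P\<^sup>*\<close>: the curve is the orbit of the base point \<open>I\<close> of
  hyperbolic space under the frame, where \<open>SL(2, \<complex>)\<close> acts by the Hermitian congruence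
  \<open>X \<mapsto> P X P\<^sup>*\<close>. This action preserves the Minkowski product and the orientation, and hence the
  Hodge star, so that both sides of the flow can be computed at the base point.

  If \<open>P\<close> moves with logarithmic derivative \<open>M\<close>, then \<open>P X P\<^sup>*\<close> moves with
  \<open>P (M X + X M\<^sup>*) P\<^sup>*\<close>. The matrices \<open>a\<close>, \<open>u\<close> and \<open>Q\<^sub>-\<^sub>1\<close> are skew-Hermitian, so with
  \<open>lam = r - \<i> s\<close> only the imaginary parts of \<open>lam\<close> and \<open>lam\<^sup>2\<close> survive:
  \<open>\<eta>\<^sub>x = 2 s P a\<^sub>M P\<^sup>*\<close> and \<open>\<eta>\<^sub>t = P (4 r s a\<^sub>M - 2 \<i> s u) P\<^sup>*\<close>. In the time derivative the first term is
  tangential; once the time parameter runs at speed \<open>1 / (2 s\<^sup>2)\<close>, moving the spatial parameter with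
  velocity \<open>- r / s\<^sup>2\<close> cancels it. Dividing \<open>x\<close> by \<open>2 s\<close> makes it arc length, with unit tangent \<open>P a\<^sub>M P\<^sup>*\<close>. One more derivative gives
  \<open>\<gamma>\<^sub>x\<^sub>x = \<gamma> + P N P\<^sup>*\<close>, where \<open>N\<close> is the off-diagonal Hermitian matrix with upper entry
  \<open>- q / s\<close>; hence the curvature vector is \<open>P N P\<^sup>*\<close>. The normal plane at the base point
  consists of the off-diagonal Hermitian matrices, which is a copy of \<open>\<complex>\<close> through the upper entry, and
  the star is multiplication by \<open>\<i>\<close> there. So the star of the curvature has upper entry
  \<open>- \<i> q / s\<close>, which is exactly what remains of the time derivative.
\<close>

section \<open>Hermitian congruence of two-by-two matrices\<close>

definition adj2 :: "cmat2 \<Rightarrow> cmat2" where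
  "adj2 A = mat22 (A $ 2 $ 2) (- A $ 1 $ 2) (- A $ 2 $ 1) (A $ 1 $ 1)"

text \<open>The action of \<open>SL(2, \<complex>)\<close> on Minkowski space; it covers the connected Lorentz group.\<close>

definition congr :: "cmat2 \<Rightarrow> cmat2 \<Rightarrow> cmat2" where
  "congr P X = P ** X ** ctransp P"

definition aM :: cmat2 where
  "aM = mat22 1 0 0 (- 1)"

text \<open>These matrices form the normal plane of a curve through the identity with tangent \<open>a\<^sub>M\<close>.
  The basis vectors \<open>b\<^sub>M\<close> and \<open>c\<^sub>M\<close> are the values at \<open>- \<i>\<close> and \<open>1\<close>.\<close>

definition offdiag :: "complex \<Rightarrow> cmat2" where
  "offdiag z = mat22 0 z (cnj z) 0"

lemma mat22_nth [simp]:
  "mat22 a b c d $ 1 $ 1 = a" "mat22 a b c d $ 1 $ 2 = b"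
  "mat22 a b c d $ 2 $ 1 = c" "mat22 a b c d $ 2 $ 2 = d"
  by (simp_all add: mat22_def)

lemma cmat2_eq_iff:
  "(A::cmat2) = B \<longleftrightarrow> A $ 1 $ 1 = B $ 1 $ 1 \<and> A $ 1 $ 2 = B $ 1 $ 2 \<and>
     A $ 2 $ 1 = B $ 2 $ 1 \<and> A $ 2 $ 2 = B $ 2 $ 2"
  by (auto simp: vec_eq_iff forall_2)

lemma mult_nth: "((A::cmat2) ** B) $ i $ j = A $ i $ 1 * B $ 1 $ j + A $ i $ 2 * B $ 2 $ j"
  by (simp add: matrix_matrix_mult_def sum_2)

lemma mat1_nth: "(mat 1 :: cmat2) $ i $ j = (if i = j then 1 else 0)"
  by (simp add: mat_def)

lemma ctransp_nth [simp]: "ctransp A $ i $ j = cnj (A $ j $ i)"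
  by (simp add: ctransp_def)

lemma cscale_nth [simp]: "cscale c A $ i $ j = c * A $ i $ j"
  by (simp add: cscale_def)

lemma ctransp_mult: "ctransp (A ** B) = ctransp B ** ctransp A"
  by (simp add: cmat2_eq_iff mult_nth mult.commute)

lemma ctransp_ctransp [simp]: "ctransp (ctransp A) = A"
  by (simp add: cmat2_eq_iff)

lemma adj2_mult: "adj2 (A ** B) = adj2 B ** adj2 A"
  by (simp add: cmat2_eq_iff mult_nth adj2_def algebra_simps)

lemma adj2_inverse:
  assumes "det P = 1"
  shows "adj2 P ** P = mat 1" "P ** adj2 P = mat 1"
  using assms by (simp_all add: cmat2_eq_iff mult_nth adj2_def det_2 mat1_nth algebra_simps)

lemma det_ctransp: "det (ctransp P) = cnj (det P)"
  by (simp add: det_2 mult.commute)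

lemma self_adjoint_congr: "self_adjoint X \<Longrightarrow> self_adjoint (congr P X)"
  by (simp add: self_adjoint_def congr_def ctransp_mult matrix_mul_assoc)

lemma congr_mult: "congr P (congr R X) = congr (P ** R) X"
  by (simp add: congr_def ctransp_mult matrix_mul_assoc)

lemma congr_1: "congr (mat 1) X = X"
  by (simp add: congr_def cmat2_eq_iff mult_nth mat1_nth)

lemma congr_add: "congr P (X + Y) = congr P X + congr P Y"
  by (simp add: congr_def cmat2_eq_iff mult_nth algebra_simps)

lemma congr_diff: "congr P (X - Y) = congr P X - congr P Y"
  by (simp add: congr_def cmat2_eq_iff mult_nth algebra_simps)

lemma congr_scaleR: "congr P (k *\<^sub>R X) = k *\<^sub>R congr P X"
  by (simp add: congr_def cmat2_eq_iff mult_nth scaleR_conv_of_real[where 'a=complex] algebra_simps)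

lemma det_congr: "det P = 1 \<Longrightarrow> det (congr P X) = det X"
  by (simp add: congr_def det_mul det_ctransp)

text \<open>For unimodular \<open>P\<close> the adjugate is the inverse, so \<open>adj2\<close> turns a congruence by \<open>P\<close> into one
  by the inverse adjoint. In a product that alternates \<open>X\<close> with \<open>adj2 Y\<close> the inner
  factors cancel and the outer ones conjugate the product. Such traces are therefore Lorentz invariants, and
  they express both the inner product and the volume form.\<close>

lemma trace_alternating_congr:
  assumes "det P = 1"
  shows "trace (congr P X ** adj2 (congr P Y)) = trace (X ** adj2 Y)"
    and "trace (congr P X ** adj2 (congr P Y) ** congr P Z ** adj2 (congr P W)) =
      trace (X ** adj2 Y ** Z ** adj2 W)"
proof -
  have inv: "ctransp P ** adj2 (ctransp P) = mat 1" "adj2 P ** P = mat 1"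
    using assms by (auto intro: adj2_inverse simp: det_ctransp)
  have pair: "congr P X ** adj2 (congr P Y) = P ** (X ** adj2 Y) ** adj2 P" for X Y
  proof -
    have "congr P X ** adj2 (congr P Y) =
        P ** X ** (ctransp P ** adj2 (ctransp P)) ** adj2 Y ** adj2 P"
      by (simp only: congr_def adj2_mult matrix_mul_assoc)
    then show ?thesis
      by (simp only: inv matrix_mul_rid matrix_mul_assoc)
  qed
  have trace_conj: "trace (P ** A ** adj2 P) = trace A" for A
  proof -
    have "trace (P ** A ** adj2 P) = trace (adj2 P ** (P ** A))"
      by (rule trace_mul_sym)
    then show ?thesis
      by (simp only: matrix_mul_assoc inv matrix_mul_lid)
  qed
  show "trace (congr P X ** adj2 (congr P Y)) = trace (X ** adj2 Y)"
    by (simp only: pair trace_conj)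
  have "congr P X ** adj2 (congr P Y) ** congr P Z ** adj2 (congr P W) =
      (congr P X ** adj2 (congr P Y)) ** (congr P Z ** adj2 (congr P W))"
    by (simp only: matrix_mul_assoc)
  also have "\<dots> = P ** (X ** adj2 Y) ** (adj2 P ** P) ** (Z ** adj2 W) ** adj2 P"
    by (simp only: pair matrix_mul_assoc)
  also have "\<dots> = P ** (X ** adj2 Y ** Z ** adj2 W) ** adj2 P"
    by (simp only: inv matrix_mul_rid matrix_mul_assoc)
  finally show "trace (congr P X ** adj2 (congr P Y) ** congr P Z ** adj2 (congr P W)) =
      trace (X ** adj2 Y ** Z ** adj2 W)"
    by (simp only: trace_conj)
qed

section \<open>Invariance of the Minkowski product and of the orientation\<close>

text \<open>Polarization of \<open>mink X X = - det X\<close>, since \<open>X ** adj2 X\<close> is the scalar matrix \<open>det X\<close>.\<close>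

lemma mink_trace:
  assumes "self_adjoint X" "self_adjoint Y"
  shows "mink X Y = - Re (trace (X ** adj2 Y)) / 2"
  using assms
  by (simp add: self_adjoint_iff mink_def Let_def mink_coord_def trace_def sum_2 mult_nth adj2_def
      field_simps)

lemma mink_add_left: "mink (X + Y) Z = mink X Z + mink Y Z"
  by (simp add: mink_def Let_def mink_coord_def field_simps)

lemma mink_congr:
  assumes "det P = 1" "self_adjoint X" "self_adjoint Y"
  shows "mink (congr P X) (congr P Y) = mink X Y"
  using assms by (simp add: mink_trace self_adjoint_congr trace_alternating_congr)

text \<open>On Hermitian matrices this is the volume form normalized by the value \<open>1\<close> on the basis
  \<open>(I, a\<^sub>M, b\<^sub>M, c\<^sub>M)\<close>. Written as an alternating trace, its invariance under congruence is immediate,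
  whereas the determinant of coordinates would require the determinant of the congruence itself.\<close>

definition volume :: "cmat2 \<Rightarrow> cmat2 \<Rightarrow> cmat2 \<Rightarrow> cmat2 \<Rightarrow> real" where
  "volume X Y Z W = - Im (trace (X ** adj2 Y ** Z ** adj2 W)) / 2"

lemma volume_congr:
  "det P = 1 \<Longrightarrow> volume (congr P X) (congr P Y) (congr P Z) (congr P W) = volume X Y Z W"
  by (simp add: volume_def trace_alternating_congr)

lemma det_4:
  "det (A :: 'a::comm_ring_1^4^4) =
    A$1$1 * A$2$2 * A$3$3 * A$4$4 - A$1$1 * A$2$2 * A$3$4 * A$4$3
  - A$1$1 * A$2$3 * A$3$2 * A$4$4 + A$1$1 * A$2$3 * A$3$4 * A$4$2
  + A$1$1 * A$2$4 * A$3$2 * A$4$3 - A$1$1 * A$2$4 * A$3$3 * A$4$2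
  - A$1$2 * A$2$1 * A$3$3 * A$4$4 + A$1$2 * A$2$1 * A$3$4 * A$4$3
  + A$1$2 * A$2$3 * A$3$1 * A$4$4 - A$1$2 * A$2$3 * A$3$4 * A$4$1
  - A$1$2 * A$2$4 * A$3$1 * A$4$3 + A$1$2 * A$2$4 * A$3$3 * A$4$1
  + A$1$3 * A$2$1 * A$3$2 * A$4$4 - A$1$3 * A$2$1 * A$3$4 * A$4$2
  - A$1$3 * A$2$2 * A$3$1 * A$4$4 + A$1$3 * A$2$2 * A$3$4 * A$4$1
  + A$1$3 * A$2$4 * A$3$1 * A$4$2 - A$1$3 * A$2$4 * A$3$2 * A$4$1
  - A$1$4 * A$2$1 * A$3$2 * A$4$3 + A$1$4 * A$2$1 * A$3$3 * A$4$2
  + A$1$4 * A$2$2 * A$3$1 * A$4$3 - A$1$4 * A$2$2 * A$3$3 * A$4$1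
  - A$1$4 * A$2$3 * A$3$1 * A$4$2 + A$1$4 * A$2$3 * A$3$2 * A$4$1"
proof -
  have f: "finite {2::4, 3, 4}" "1 \<notin> {2::4, 3, 4}" "finite {3::4, 4}" "2 \<notin> {3::4, 4}"
      "finite {4::4}" "3 \<notin> {4::4}"
    by auto
  show ?thesis
    unfolding det_def UNIV_4
    unfolding sum_over_permutations_insert[OF f(1,2)] sum_over_permutations_insert[OF f(3,4)]
      sum_over_permutations_insert[OF f(5,6)] permutes_sing
    by (simp add: sign_swap_id permutation_swap_id sign_compose permutation_compose sign_id swap_id_eq)
qed

text \<open>The sign comes from \<open>a\<^sub>M\<close>, whose coordinate \<open>x\<^sub>3\<close> is \<open>- 1\<close>.\<close>

lemma basis_combination:
  "(\<Sum>j\<in>UNIV. c $ j *\<^sub>R mink_basis $ j) = mink_mat (c $ 1) (c $ 4) (c $ 3) (- c $ 2)"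
  by (simp add: sum_4 mink_basis_def mink_mat_def cmat2_eq_iff mat1_nth complex_eq_iff)

text \<open>The right-hand side is the determinant of the coordinates, expanded along its first row.\<close>

lemma volume_mink_mat:
  "volume (mink_mat a0 a3 a2 (- a1)) (mink_mat b0 b3 b2 (- b1))
     (mink_mat c0 c3 c2 (- c1)) (mink_mat d0 d3 d2 (- d1)) =
   a0 * (b1 * (c2 * d3 - c3 * d2) - b2 * (c1 * d3 - c3 * d1) + b3 * (c1 * d2 - c2 * d1))
 - a1 * (b0 * (c2 * d3 - c3 * d2) - b2 * (c0 * d3 - c3 * d0) + b3 * (c0 * d2 - c2 * d0))
 + a2 * (b0 * (c1 * d3 - c3 * d1) - b1 * (c0 * d3 - c3 * d0) + b3 * (c0 * d1 - c1 * d0))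
 - a3 * (b0 * (c1 * d2 - c2 * d1) - b1 * (c0 * d2 - c2 * d0) + b2 * (c0 * d1 - c1 * d0))"
  (is "?vol = ?det")
proof -
  have "2 * ?vol = 2 * ?det"
    unfolding volume_def mink_mat_def trace_def sum_2 mult_nth adj2_def mat22_nth
    by simp algebra
  then show ?thesis by simp
qed

lemma volume_basis_combination:
  assumes "\<And>i. (vector [v1, v2, v3, v4] :: cmat2^4) $ i = (\<Sum>j\<in>UNIV. A $ i $ j *\<^sub>R mink_basis $ j)"
  shows "volume v1 v2 v3 v4 = det A"
proof -
  have v: "v1 = mink_mat (A $ 1 $ 1) (A $ 1 $ 4) (A $ 1 $ 3) (- A $ 1 $ 2)"
      "v2 = mink_mat (A $ 2 $ 1) (A $ 2 $ 4) (A $ 2 $ 3) (- A $ 2 $ 2)"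
      "v3 = mink_mat (A $ 3 $ 1) (A $ 3 $ 4) (A $ 3 $ 3) (- A $ 3 $ 2)"
      "v4 = mink_mat (A $ 4 $ 1) (A $ 4 $ 4) (A $ 4 $ 3) (- A $ 4 $ 2)"
    by (rule assms[of 1, unfolded vector_4_nth basis_combination]
        assms[of 2, unfolded vector_4_nth basis_combination]
        assms[of 3, unfolded vector_4_nth basis_combination]
        assms[of 4, unfolded vector_4_nth basis_combination])+
  show ?thesis
    unfolding v volume_mink_mat det_4 by algebra
qed

text \<open>This replaces the existential over coordinate matrices by the sign of an invariant, so that
  orientations can be carried along a congruence.\<close>

lemma pos_oriented_iff_volume:
  assumes "self_adjoint v1" "self_adjoint v2" "self_adjoint v3" "self_adjoint v4"
  shows "pos_oriented v1 v2 v3 v4 \<longleftrightarrow> volume v1 v2 v3 v4 > 0"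
proof
  assume "pos_oriented v1 v2 v3 v4"
  then obtain A :: "real^4^4" where "det A > 0"
    and A: "\<And>i. (vector [v1, v2, v3, v4] :: cmat2^4) $ i = (\<Sum>j\<in>UNIV. A $ i $ j *\<^sub>R mink_basis $ j)"
    unfolding pos_oriented_def by blast
  with volume_basis_combination[OF A] show "volume v1 v2 v3 v4 > 0"
    by (simp only:)
next
  assume pos: "volume v1 v2 v3 v4 > 0"
  define c where "c X = (vector [mink_coord X $ 1, - mink_coord X $ 4, mink_coord X $ 3,
    mink_coord X $ 2] :: real^4)" for X
  have c: "(\<Sum>j\<in>UNIV. c X $ j *\<^sub>R mink_basis $ j) = X" if "self_adjoint X" for X
    using mink_mat_mink_coord[OF that] by (simp only: basis_combination c_def vector_4_nth minus_minus)
  define A :: "real^4^4" where "A = vector [c v1, c v2, c v3, c v4]"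
  have A: "(vector [v1, v2, v3, v4] :: cmat2^4) $ i = (\<Sum>j\<in>UNIV. A $ i $ j *\<^sub>R mink_basis $ j)" for i
    using exhaust_4[of i] by (elim disjE) (simp_all only: A_def vector_4_nth c assms)
  have "det A > 0"
    using pos volume_basis_combination[OF A] by (simp only:)
  with A show "pos_oriented v1 v2 v3 v4"
    unfolding pos_oriented_def by blast
qed

section \<open>The Hodge star at the base point\<close>

lemma self_adjoint_special [simp]:
  "self_adjoint (mat 1)" "self_adjoint aM" "self_adjoint (offdiag z)"
  by (simp_all add: self_adjoint_iff aM_def offdiag_def mat1_nth)

lemma mink_standard:
  "mink (offdiag z) (offdiag w) = Re (z * cnj w)"
  "mink (offdiag z) (mat 1) = 0" "mink (offdiag z) aM = 0"
  "mink (mat 1) (mat 1) = -1" "mink aM aM = 1" "mink (mat 1) aM = 0"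
  by (simp_all add: mink_def Let_def mink_coord_def offdiag_def aM_def mat1_nth)

lemma volume_offdiag: "volume (mat 1) aM (offdiag z) (offdiag w) = Im (cnj z * w)"
  by (simp add: volume_def trace_def sum_2 mult_nth adj2_def offdiag_def aM_def mat1_nth field_simps)

lemma orthogonal_eq_offdiag:
  assumes "self_adjoint N" "mink N (mat 1) = 0" "mink N aM = 0"
  shows "N = offdiag (N $ 1 $ 2)"
  using assms
  by (simp add: self_adjoint_iff mink_def Let_def mink_coord_def offdiag_def aM_def mat1_nth
      cmat2_eq_iff complex_eq_iff)

text \<open>Invariance reduces the claim to \<open>P = mat 1\<close>. There \<open>z\<close> and \<open>w\<close> are orthonormal in \<open>\<complex>\<close>, so
  \<open>cnj z * w\<close> has modulus one and vanishing real part, and the orientation selects \<open>\<i>\<close> against \<open>- \<i>\<close>.\<close>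

lemma normal_frame_congr_offdiag:
  assumes "det P = 1"
  shows "normal_frame (congr P (mat 1)) (congr P aM) (congr P (offdiag z)) (congr P (offdiag w))
    \<longleftrightarrow> cmod z = 1 \<and> w = \<i> * z"
proof -
  have "normal_frame (congr P (mat 1)) (congr P aM) (congr P (offdiag z)) (congr P (offdiag w))
    \<longleftrightarrow> Re (z * cnj z) = 1 \<and> Re (w * cnj w) = 1 \<and> Re (z * cnj w) = 0 \<and> Im (cnj z * w) > 0"
    unfolding normal_frame_def
    by (simp add: self_adjoint_congr mink_congr pos_oriented_iff_volume volume_congr mink_standard
        volume_offdiag assms)
  also have "\<dots> \<longleftrightarrow> cmod z = 1 \<and> w = \<i> * z"
  proof
    assume h: "Re (z * cnj z) = 1 \<and> Re (w * cnj w) = 1 \<and> Re (z * cnj w) = 0 \<and> Im (cnj z * w) > 0"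
    have z: "cmod z = 1" and w: "cmod w = 1"
      using h by (simp_all add: cmod_def power2_eq_square)
    have "cmod (cnj z * w) = 1"
      by (simp add: norm_mult z w)
    moreover have "Re (cnj z * w) = 0" using h by simp
    ultimately have "cnj z * w = \<i>"
      using h by (auto simp: complex_eq_iff cmod_def power2_eq_1_iff)
    then have "z * cnj z * w = \<i> * z"
      by (metis mult.assoc mult.commute)
    moreover have "z * cnj z = 1"
      using z complex_norm_square[of z] by simp
    ultimately show "cmod z = 1 \<and> w = \<i> * z"
      using z by simp
  next
    assume h: "cmod z = 1 \<and> w = \<i> * z"
    then have "z * cnj z = 1"
      using complex_norm_square[of z] by simp
    then have "Re z * Re z + Im z * Im z = 1"
      by (simp add: complex_eq_iff)
    with h show "Re (z * cnj z) = 1 \<and> Re (w * cnj w) = 1 \<and> Re (z * cnj w) = 0 \<and> Im (cnj z * w) > 0"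
      by simp
  qed
  finally show ?thesis .
qed

text \<open>Every normal frame arises in this way, because a normal vector pulled back by \<open>P\<close> is orthogonal to
  the identity and to \<open>a\<^sub>M\<close>.\<close>

lemma normal_frame_congrE:
  assumes "det P = 1" "normal_frame (congr P (mat 1)) (congr P aM) n2 n3"
  obtains z where "n2 = congr P (offdiag z)" "n3 = congr P (offdiag (\<i> * z))"
proof -
  have off: "\<exists>z. n = congr P (offdiag z)"
    if n: "self_adjoint n" "mink n (congr P (mat 1)) = 0" "mink n (congr P aM) = 0" for n
  proof -
    define N where "N = congr (adj2 P) n"
    have nN: "n = congr P N"
      by (simp add: N_def congr_mult adj2_inverse assms(1) congr_1)
    have N: "self_adjoint N"
      using n by (simp add: N_def self_adjoint_congr)
    with n have "N = offdiag (N $ 1 $ 2)"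
      by (intro orthogonal_eq_offdiag) (simp_all add: nN mink_congr assms(1))
    with nN show ?thesis by metis
  qed
  obtain z w where zw: "n2 = congr P (offdiag z)" "n3 = congr P (offdiag w)"
    using assms(2) off unfolding normal_frame_def by meson
  with assms normal_frame_congr_offdiag[of P z w] that show thesis by blast
qed

lemma offdiag_linear:
  "offdiag z + offdiag w = offdiag (z + w)" "offdiag z - offdiag w = offdiag (z - w)"
  "k *\<^sub>R offdiag z = offdiag (of_real k * z)"
  by (simp_all add: offdiag_def cmat2_eq_iff scaleR_conv_of_real[where 'a=complex])

lemma congr_offdiag_eq_iff:
  assumes "det P = 1"
  shows "congr P (offdiag z) = congr P (offdiag w) \<longleftrightarrow> z = w"
proof
  assume "congr P (offdiag z) = congr P (offdiag w)"
  then have "congr (adj2 P) (congr P (offdiag z)) = congr (adj2 P) (congr P (offdiag w))"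
    by simp
  then show "z = w"
    by (simp add: congr_mult adj2_inverse assms congr_1) (simp add: offdiag_def cmat2_eq_iff)
qed simp

text \<open>Any two normal frames differ by a rotation of \<open>\<complex>\<close>, which commutes with multiplication by \<open>\<i>\<close>; this is
  why the description in \<open>hodge_star\<close> determines a single vector. The frame with \<open>z = 1\<close> shows that it
  exists.\<close>

lemma hodge_star_congr:
  assumes "det P = 1"
  shows "hodge_star (congr P (mat 1)) (congr P aM) (congr P (offdiag z)) = congr P (offdiag (\<i> * z))"
  unfolding hodge_star_def
proof (rule the_equality)
  let ?nf = "normal_frame (congr P (mat 1)) (congr P aM)"
  have "?nf (congr P (offdiag 1)) (congr P (offdiag \<i>))"
    using assms by (simp add: normal_frame_congr_offdiag)
  moreover have "congr P (offdiag z) = Re z *\<^sub>R congr P (offdiag 1) + Im z *\<^sub>R congr P (offdiag \<i>)"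
    "congr P (offdiag (\<i> * z)) = Re z *\<^sub>R congr P (offdiag \<i>) - Im z *\<^sub>R congr P (offdiag 1)"
    by (simp_all flip: congr_scaleR congr_add congr_diff
        add: offdiag_linear congr_offdiag_eq_iff assms complex_eq_iff)
  ultimately show "\<exists>n2 n3 \<xi>1 \<xi>2. ?nf n2 n3 \<and> congr P (offdiag z) = \<xi>1 *\<^sub>R n2 + \<xi>2 *\<^sub>R n3 \<and>
      congr P (offdiag (\<i> * z)) = \<xi>1 *\<^sub>R n3 - \<xi>2 *\<^sub>R n2"
    by blast
next
  fix w
  assume "\<exists>n2 n3 \<xi>1 \<xi>2. normal_frame (congr P (mat 1)) (congr P aM) n2 n3 \<and>
      congr P (offdiag z) = \<xi>1 *\<^sub>R n2 + \<xi>2 *\<^sub>R n3 \<and> w = \<xi>1 *\<^sub>R n3 - \<xi>2 *\<^sub>R n2"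
  then obtain n2 n3 \<xi>1 \<xi>2 where nf: "normal_frame (congr P (mat 1)) (congr P aM) n2 n3"
    and z: "congr P (offdiag z) = \<xi>1 *\<^sub>R n2 + \<xi>2 *\<^sub>R n3" and w: "w = \<xi>1 *\<^sub>R n3 - \<xi>2 *\<^sub>R n2"
    by blast
  obtain k where k: "n2 = congr P (offdiag k)" "n3 = congr P (offdiag (\<i> * k))"
    using normal_frame_congrE[OF assms nf] .
  have zk: "z = of_real \<xi>1 * k + of_real \<xi>2 * (\<i> * k)"
    using z by (simp add: k offdiag_linear congr_offdiag_eq_iff assms flip: congr_scaleR congr_add)
  show "w = congr P (offdiag (\<i> * z))"
    unfolding w k
    by (simp add: offdiag_linear congr_offdiag_eq_iff assms zk algebra_simps
        flip: congr_scaleR congr_diff)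
qed

section \<open>Derivatives along straight lines\<close>

text \<open>The chain rule for the affine change of variables from \<open>\<eta>\<close> to \<open>\<gamma>\<close>. For fixed \<open>x\<close> both
  arguments of \<open>\<eta>\<close> vary with time, so joint differentiability is essential.\<close>

lemma has_vector_derivative_along_line:
  fixes f :: "real \<Rightarrow> real \<Rightarrow> 'a::real_normed_vector"
  assumes "(\<lambda>p. f (fst p) (snd p)) differentiable at (a + b * \<tau>, c + d * \<tau>)"
  shows "((\<lambda>\<tau>. f (a + b * \<tau>) (c + d * \<tau>)) has_vector_derivative
     (b *\<^sub>R dx f (a + b * \<tau>) (c + d * \<tau>) + d *\<^sub>R dt f (a + b * \<tau>) (c + d * \<tau>))) (at \<tau>)"
proof -
  define x t where "x = a + b * \<tau>" and "t = c + d * \<tau>"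
  obtain D where D: "((\<lambda>p. f (fst p) (snd p)) has_derivative D) (at (x, t))"
    using assms unfolding differentiable_def x_def t_def by blast
  then interpret D: bounded_linear D
    by (rule has_derivative_bounded_linear)
  have line: "((\<lambda>s. f (fst (g s)) (snd (g s))) has_vector_derivative D (h, k)) (at s)"
    if "(g has_vector_derivative (h, k)) (at s)" "g s = (x, t)" for g :: "real \<Rightarrow> real \<times> real" and h k s
    using vector_derivative_diff_chain_within[OF that(1), of "\<lambda>p. f (fst p) (snd p)" D] D that(2)
    by (simp add: o_def has_derivative_at_withinI)
  have "((\<lambda>y. f y t) has_vector_derivative D (1, 0)) (at x)"
    by (rule line[where g = "\<lambda>y. (y, t)", simplified]) (auto intro!: derivative_eq_intros)
  then have dx: "dx f x t = D (1, 0)"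
    unfolding dx_def by (rule vector_derivative_at)
  have "((\<lambda>y. f x y) has_vector_derivative D (0, 1)) (at t)"
    by (rule line[where g = "\<lambda>y. (x, y)", simplified]) (auto intro!: derivative_eq_intros)
  then have dt: "dt f x t = D (0, 1)"
    unfolding dt_def by (rule vector_derivative_at)
  have "D (b, d) = D (b *\<^sub>R (1, 0) + d *\<^sub>R (0, 1))"
    by simp
  also have "\<dots> = b *\<^sub>R dx f x t + d *\<^sub>R dt f x t"
    by (simp only: D.add D.scaleR dx dt)
  finally have *: "D (b, d) = b *\<^sub>R dx f x t + d *\<^sub>R dt f x t" .
  have "((\<lambda>s. (a + b * s, c + d * s)) has_vector_derivative (b, d)) (at \<tau>)"
    by (auto intro!: derivative_eq_intros)
  from line[OF this] show ?thesis
    by (simp add: * x_def t_def)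
qed

lemma has_vector_derivative_congr:
  assumes P: "(P has_vector_derivative P s ** M) (at s)"
  shows "((\<lambda>s. congr (P s) X) has_vector_derivative congr (P s) (M ** X + X ** ctransp M)) (at s)"
proof -
  have mult: "bounded_bilinear ((**) :: cmat2 \<Rightarrow> cmat2 \<Rightarrow> cmat2)"
    unfolding bilinear_conv_bounded_bilinear[symmetric]
    by (auto simp: bilinear_def cmat2_eq_iff mult_nth algebra_simps intro!: linearI)
  have lin: "bounded_linear ctransp"
    unfolding linear_conv_bounded_linear[symmetric]
    by (auto simp: cmat2_eq_iff intro!: linearI)
  note d = bounded_bilinear.has_vector_derivative[OF mult]
  have "((\<lambda>s. P s ** X ** ctransp (P s)) has_vector_derivative
     P s ** X ** ctransp (P s ** M) + (P s ** 0 + P s ** M ** X) ** ctransp (P s)) (at s)"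
    by (intro d P has_vector_derivative_const bounded_linear.has_vector_derivative[OF lin])
  moreover have "P s ** X ** ctransp (P s ** M) + (P s ** 0 + P s ** M ** X) ** ctransp (P s) =
      congr (P s) (M ** X + X ** ctransp M)"
    by (simp add: congr_def cmat2_eq_iff mult_nth algebra_simps)
  ultimately show ?thesis
    by (simp add: congr_def)
qed

section \<open>Frames and the flow\<close>

definition Lax_x :: "complex \<Rightarrow> (real \<Rightarrow> real \<Rightarrow> complex) \<Rightarrow> real \<Rightarrow> real \<Rightarrow> cmat2" where
  "Lax_x lam q x t = cscale lam a_mat + u_mat q x t"

definition Lax_t :: "complex \<Rightarrow> (real \<Rightarrow> real \<Rightarrow> complex) \<Rightarrow> real \<Rightarrow> real \<Rightarrow> cmat2" where
  "Lax_t lam q x t =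
     cscale (lam\<^sup>2) a_mat + cscale lam (u_mat q x t) + Q_mat q x t - cscale (1 / 4) a_mat"

lemma matrix_inv_eqI:
  fixes A B :: "'a::field^'n^'n"
  assumes "A ** B = mat 1"
  shows "matrix_inv A = B"
proof -
  have "A ** B = mat 1 \<and> B ** A = mat 1"
    using assms matrix_left_right_inverse by blast
  then have "matrix_inv A ** A = mat 1"
    unfolding matrix_inv_def by (rule someI2) blast
  then show ?thesis
    by (metis assms matrix_mul_assoc matrix_mul_lid matrix_mul_rid)
qed

lemma frame_equations:
  assumes "is_frame q E"
  shows "det (E x t lam) = 1"
    and "E x t lam ** matrix_inv (E x t (cnj lam)) = congr (E x t lam) (mat 1)"
    and "dx (\<lambda>x t. E x t lam) x t = E x t lam ** Lax_x lam q x t"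
    and "dt (\<lambda>x t. E x t lam) x t = E x t lam ** Lax_t lam q x t"
    and "(\<lambda>p. E (fst p) (snd p) lam) differentiable at p"
proof -
  show det: "det (E x t lam) = 1"
    using assms unfolding is_frame_def by blast
  show "(\<lambda>p. E (fst p) (snd p) lam) differentiable at p"
    using assms unfolding is_frame_def by blast
  have "ctransp (E x t lam) ** E x t (cnj lam) = mat 1"
    using assms unfolding is_frame_def by (metis complex_cnj_cnj)
  then have "matrix_inv (E x t (cnj lam)) = ctransp (E x t lam)"
    using matrix_inv_eqI matrix_left_right_inverse by blast
  then show "E x t lam ** matrix_inv (E x t (cnj lam)) = congr (E x t lam) (mat 1)"
    by (simp add: congr_def)
  have inv: "E x t lam ** matrix_inv (E x t lam) = mat 1"
    using matrix_inv_eqI[OF adj2_inverse(2)[OF det]] adj2_inverse(2)[OF det] by simp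
  have Ex: "matrix_inv (E x t lam) ** dx (\<lambda>x t. E x t lam) x t = Lax_x lam q x t"
    using assms unfolding is_frame_def Lax_x_def by blast
  have Et: "matrix_inv (E x t lam) ** dt (\<lambda>x t. E x t lam) x t = Lax_t lam q x t"
    using assms unfolding is_frame_def Lax_t_def by blast
  show "dx (\<lambda>x t. E x t lam) x t = E x t lam ** Lax_x lam q x t"
    by (metis Ex inv matrix_mul_assoc matrix_mul_lid)
  show "dt (\<lambda>x t. E x t lam) x t = E x t lam ** Lax_t lam q x t"
    by (metis Et inv matrix_mul_assoc matrix_mul_lid)
qed

lemma frame_congr_along_line:
  assumes "is_frame q E"
  shows "((\<lambda>\<tau>. congr (E (a + b * \<tau>) (c + d * \<tau>) lam) X) has_vector_derivative
     congr (E (a + b * \<tau>) (c + d * \<tau>) lam)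
       (b *\<^sub>R (Lax_x lam q (a + b * \<tau>) (c + d * \<tau>) ** X
              + X ** ctransp (Lax_x lam q (a + b * \<tau>) (c + d * \<tau>)))
        + d *\<^sub>R (Lax_t lam q (a + b * \<tau>) (c + d * \<tau>) ** X
              + X ** ctransp (Lax_t lam q (a + b * \<tau>) (c + d * \<tau>))))) (at \<tau>)"
proof -
  let ?E = "E (a + b * \<tau>) (c + d * \<tau>) lam"
  let ?A = "Lax_x lam q (a + b * \<tau>) (c + d * \<tau>)"
  let ?B = "Lax_t lam q (a + b * \<tau>) (c + d * \<tau>)"
  have "b *\<^sub>R (?E ** ?A) + d *\<^sub>R (?E ** ?B) = ?E ** (b *\<^sub>R ?A + d *\<^sub>R ?B)"
    by (simp add: cmat2_eq_iff mult_nth algebra_simps)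
  with has_vector_derivative_along_line[where f = "\<lambda>x t. E x t lam" and a = a and b = b
      and \<tau> = \<tau> and c = c and d = d, OF frame_equations(5)[OF assms]]
  have "((\<lambda>\<tau>. E (a + b * \<tau>) (c + d * \<tau>) lam) has_vector_derivative
      ?E ** (b *\<^sub>R ?A + d *\<^sub>R ?B)) (at \<tau>)"
    by (simp only: frame_equations(3,4)[OF assms])
  note has_vector_derivative_congr[OF this, of X]
  moreover have "(b *\<^sub>R ?A + d *\<^sub>R ?B) ** X + X ** ctransp (b *\<^sub>R ?A + d *\<^sub>R ?B) =
      b *\<^sub>R (?A ** X + X ** ctransp ?A) + d *\<^sub>R (?B ** X + X ** ctransp ?B)"
    by (simp add: cmat2_eq_iff mult_nth scaleR_conv_of_real[where 'a=complex] algebra_simps)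
  ultimately show ?thesis by simp
qed

text \<open>Skew-Hermitian \<open>a\<close>, \<open>u\<close>, \<open>Q\<^sub>-\<^sub>1\<close> leave only \<open>lam - cnj lam = - 2 \<i> s\<close> and
  \<open>lam\<^sup>2 - (cnj lam)\<^sup>2 = - 4 \<i> r s\<close>, and \<open>- \<i> a = a\<^sub>M\<close>. In the middle equation the commutator of \<open>u\<close>
  with \<open>a\<^sub>M\<close> produces the curvature.\<close>

lemma Lax_hermitian_parts:
  assumes "lam = complex_of_real r - \<i> * complex_of_real s"
  shows "Lax_x lam q x t + ctransp (Lax_x lam q x t) = (2 * s) *\<^sub>R aM"
    and "Lax_x lam q x t ** aM + aM ** ctransp (Lax_x lam q x t) =
           (2 * s) *\<^sub>R mat 1 - 2 *\<^sub>R offdiag (q x t)"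
    and "Lax_t lam q x t + ctransp (Lax_t lam q x t) =
           (4 * r * s) *\<^sub>R aM + (2 * s) *\<^sub>R offdiag (- \<i> * q x t)"
  unfolding Lax_x_def Lax_t_def assms
  by (simp_all add: a_mat_def u_mat_def Q_mat_def aM_def offdiag_def cmat2_eq_iff mult_nth mat1_nth
      complex_eq_iff power2_eq_square algebra_simps)

theorem theorem5p5:
  fixes q :: "real \<Rightarrow> real \<Rightarrow> complex"
    and E :: "real \<Rightarrow> real \<Rightarrow> complex \<Rightarrow> complex^2^2"
    and r s :: real and lam :: complex
    and \<eta> \<gamma> :: "real \<Rightarrow> real \<Rightarrow> complex^2^2"
  assumes "lam = complex_of_real r - \<i> * complex_of_real s"
    and "s > 0"
    and "solves_GP_plus q"
    and "is_frame q E"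
    and "\<And>x t. \<eta> x t = E x t lam ** matrix_inv (E x t (cnj lam))"
    and "\<And>x t. \<gamma> x t = \<eta> (x / (2 * s) - r / s\<^sup>2 * t) (t / (2 * s\<^sup>2))"
  shows "solves_star_mcf \<gamma>"
proof -
  note lam = assms(1) and s = assms(2) and frame = assms(4)
  define X where "X x t = x / (2 * s) - r / s\<^sup>2 * t" for x t
  define T where "T t = t / (2 * s\<^sup>2)" for t
  define F where "F x t = E (X x t) (T t) lam" for x t
  define Q where "Q x t = q (X x t) (T t)" for x t
  have det: "det (F x t) = 1" for x t
    by (simp add: F_def frame_equations[OF frame])
  have \<gamma>: "\<gamma> = (\<lambda>x t. congr (F x t) (mat 1))"
    by (simp add: fun_eq_iff assms(5,6) F_def X_def T_def frame_equations(2)[OF frame])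
  have x_line: "((\<lambda>y. congr (F y t) N) has_vector_derivative
      congr (F x t) ((1 / (2 * s)) *\<^sub>R (Lax_x lam q (X x t) (T t) ** N +
        N ** ctransp (Lax_x lam q (X x t) (T t))))) (at x)" for N x t
    using frame_congr_along_line[OF frame, of "- (r / s\<^sup>2 * t)" "1 / (2 * s)" "T t" 0 lam N x]
    by (simp add: F_def X_def)
  have \<gamma>x: "((\<lambda>y. congr (F y t) (mat 1)) has_vector_derivative congr (F x t) aM) (at x)" for x t
    using x_line[of t "mat 1" x] s by (simp add: Lax_hermitian_parts[OF lam])
  have "(1 / (2 * s)) *\<^sub>R ((2 * s) *\<^sub>R mat 1 - 2 *\<^sub>R offdiag (q x t)) =
      mat 1 + offdiag (- q x t / s)" for x t
    using s by (simp add: offdiag_def cmat2_eq_iff mat1_nth complex_eq_iff field_simps)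
  then have \<gamma>xx: "((\<lambda>y. congr (F y t) aM) has_vector_derivative
      congr (F x t) (mat 1) + congr (F x t) (offdiag (- Q x t / s))) (at x)" for x t
    using x_line[of t aM x] by (simp add: Lax_hermitian_parts[OF lam] Q_def congr_add)
  \<comment> \<open>The drift of the spatial parameter removes the tangential velocity.\<close>
  have "(- (r / s\<^sup>2)) *\<^sub>R ((2 * s) *\<^sub>R aM) +
      (1 / (2 * s\<^sup>2)) *\<^sub>R ((4 * r * s) *\<^sub>R aM + (2 * s) *\<^sub>R offdiag (- \<i> * q x t)) =
      offdiag (\<i> * (- q x t / s))" for x t
    using s by (simp add: offdiag_def aM_def cmat2_eq_iff complex_eq_iff field_simps power2_eq_square)
  then have \<gamma>t: "((\<lambda>\<tau>. congr (F x \<tau>) (mat 1)) has_vector_derivative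
      congr (F x t) (offdiag (\<i> * (- Q x t / s)))) (at t)" for x t
    using frame_congr_along_line[OF frame, of "x / (2 * s)" "- (r / s\<^sup>2)" 0 "1 / (2 * s\<^sup>2)" lam "mat 1" t]
    by (simp add: Lax_hermitian_parts[OF lam] F_def X_def T_def Q_def)
  have dx: "dx \<gamma> = (\<lambda>x t. congr (F x t) aM)"
    unfolding dx_def \<gamma> fun_eq_iff using \<gamma>x[THEN vector_derivative_at] by simp
  have dt: "dt \<gamma> x t = congr (F x t) (offdiag (\<i> * (- Q x t / s)))" for x t
    unfolding dt_def \<gamma> using \<gamma>t[THEN vector_derivative_at] by simp
  \<comment> \<open>The normal projection removes the term \<open>\<gamma>\<close> of the second derivative, which
    is orthogonal to hyperbolic space at the point \<open>\<gamma>\<close>.\<close>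
  have H: "mean_curvature (\<lambda>y. \<gamma> y t) x = congr (F x t) (offdiag (- Q x t / s))" for x t
    unfolding mean_curvature_def \<gamma> \<gamma>x[THEN vector_derivative_at] \<gamma>xx[THEN vector_derivative_at] Let_def
    by (simp add: normal_part_def mink_add_left mink_congr det mink_standard)
  have "classical \<gamma>"
    unfolding classical_def dx unfolding \<gamma>
    using differentiableI_vector[OF \<gamma>x] differentiableI_vector[OF \<gamma>xx] differentiableI_vector[OF \<gamma>t]
    by blast
  moreover have "\<gamma> x t \<in> H3" for x t
    by (simp add: \<gamma> H3_def self_adjoint_congr det_congr det)
  moreover have "mink (dx \<gamma> x t) (dx \<gamma> x t) = 1" for x t
    by (simp add: dx mink_congr det mink_standard)
  moreover have "dt \<gamma> x t = hodge_star (\<gamma> x t) (dx \<gamma> x t) (mean_curvature (\<lambda>y. \<gamma> y t) x)" for x t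
  proof -
    have "\<gamma> x t = congr (F x t) (mat 1)"
      by (simp add: \<gamma>)
    then show ?thesis
      by (simp only: dx dt H hodge_star_congr[OF det])
  qed
  ultimately show ?thesis
    unfolding solves_star_mcf_def by blast
qed

end
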